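(* Let $\mathbb{T}$ be a time scale, $a,b\in\mathbb{T}$, $a<b$, and let $f\in C([a,b],\mathbb{R})$. If $$\int_a^b f(t)\eta^\nabla(t)\nabla t=0\quad\text{for all }\eta\in C^1([a,b],\mathbb{R})\text{ such that }\eta(a)=\eta(b)=0,$$ then there is $c\in\mathbb{R}$ such that $f(t)=c$ for all $t\in[a,b]_\kappa$.
   Context: A time scale $\mathbb{T}$ is a nonempty closed subset of $\mathbb{R}$, with the subspace topology. $\sigma(t)=\inf\{s\in\mathbb{T}:s>t\}$ if $t\ne\sup\mathbb{T}$, $\sigma(\sup\mathbb{T})=\sup\mathbb{T}$; $\rho(t)=\sup\{s\in\mathbb{T}:s<t\}$ if $t\neq\inf\mathbb{T}$, $\rho(\inf\mathbb{T})=\inf\mathbb{T}$. A point $t$ is right-scattered if $\sigma(t)>t$, right-dense if $\sigma(t)=t$. $\mathbb{T}_\kappa=\mathbb{T}\setminus\{m\}$ if $\mathbb{T}$ has a right-scattered minimum $m$, otherwise $\mathbb{T}_\kappa=\mathbb{T}$. $f:\mathbb{T}\to\mathbb{R}$ is nabla differentiable at $t\in\mathbb{T}_\kappa$ with derivative $f^\nabla(t)$ if for all $\varepsilon>0$ there is a neighborhood $U$ of $t$ in $\mathbb{T}$ with $|f(\rho(t))-f(s)-f^\nabla(t)(\rho(t)-s)|\le\varepsilon|\rho(t)-s|$ for all $s\in U$. If $F^\nabla=f$ on $\mathbb{T}_\kappa$, then $\int_a^b f(t)\nabla t:=F(b)-F(a)$. $[a,b]$ denotes $\{t\in\mathbb{T}:a\le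 t\le b\}$, itself regarded as a time scale; $[a,b]_\kappa=[a,b]$ if $a$ is right-dense and $[\sigma(a),b]$ if $a$ is right-scattered. $C([a,b],\mathbb{R})$ is the set of continuous functions; $C^1([a,b],\mathbb{R})$ is the set of functions $[a,b]\to\mathbb{R}$ whose nabla derivative is continuous on $[a,b]_\kappa$. Standing assumption: $\mathbb{T}$ has sufficiently many points for all the expressions to make sense. *)

theory Defs
  imports "HOL-Analysis.Analysis"
begin

text \<open>A function on a time scale \<open>T\<close> is represented by a total function on the reals;
  none of the notions below depends on its values outside \<open>T\<close>.\<close>

definition time_scale :: "real set \<Rightarrow> bool" where
  "time_scale T \<longleftrightarrow> T \<noteq> {} \<and> closed T"

text \<open>For \<open>t \<in> T\<close>, the conditions \<open>t \<noteq> sup T\<close> and \<open>t \<noteq> inf T\<close>, read in the extended reals,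
  say that \<open>T\<close> has a point above, respectively below, \<open>t\<close>.  They are written in this form
  because \<^const>\<open>Sup\<close> and \<^const>\<open>Inf\<close> of an unbounded set of reals are unspecified.\<close>

definition forward_jump :: "real set \<Rightarrow> real \<Rightarrow> real" where
  "forward_jump T t = (if \<exists>s\<in>T. s > t then Inf {s \<in> T. s > t} else t)"

definition backward_jump :: "real set \<Rightarrow> real \<Rightarrow> real" where
  "backward_jump T t = (if \<exists>s\<in>T. s < t then Sup {s \<in> T. s < t} else t)"

definition right_scattered :: "real set \<Rightarrow> real \<Rightarrow> bool" where
  "right_scattered T t \<longleftrightarrow> forward_jump T t > t"

definition lower_kappa :: "real set \<Rightarrow> real set" where
  "lower_kappa T = T - {m \<in> T. (\<forall>s\<in>T. m \<le> s) \<and> right_scattered T m}"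

definition has_nabla_derivative :: "real set \<Rightarrow> (real \<Rightarrow> real) \<Rightarrow> real \<Rightarrow> real \<Rightarrow> bool" where
  "has_nabla_derivative T f D t \<longleftrightarrow>
     t \<in> lower_kappa T \<and>
     (\<forall>\<epsilon>>0. \<exists>U. openin (top_of_set T) U \<and> t \<in> U \<and>
        (\<forall>s\<in>U. \<bar>f (backward_jump T t) - f s - D * (backward_jump T t - s)\<bar>
                 \<le> \<epsilon> * \<bar>backward_jump T t - s\<bar>))"

definition nabla_differentiable :: "real set \<Rightarrow> (real \<Rightarrow> real) \<Rightarrow> real \<Rightarrow> bool" where
  "nabla_differentiable T f t \<longleftrightarrow> (\<exists>D. has_nabla_derivative T f D t)"

text \<open>The derivative is unique as soon as \<open>T\<close> has at least two points.\<close>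

definition nabla_derivative :: "real set \<Rightarrow> (real \<Rightarrow> real) \<Rightarrow> real \<Rightarrow> real" where
  "nabla_derivative T f t = (THE D. has_nabla_derivative T f D t)"

text \<open>Two antiderivatives on a time scale with at least two points differ by a constant,
  so the value does not depend on \<open>F\<close>.\<close>

definition nabla_integral :: "real set \<Rightarrow> real \<Rightarrow> real \<Rightarrow> (real \<Rightarrow> real) \<Rightarrow> real" where
  "nabla_integral T a b f =
     (THE I. \<exists>F. (\<forall>t\<in>lower_kappa T. has_nabla_derivative T F (f t) t) \<and> I = F b - F a)"

definition ts_interval :: "real set \<Rightarrow> real \<Rightarrow> real \<Rightarrow> real set" where
  "ts_interval T a b = {t \<in> T. a \<le> t \<and> t \<le> b}"

definition nabla_C1 :: "real set \<Rightarrow> (real \<Rightarrow> real) set" where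
  "nabla_C1 T = {f. (\<forall>t\<in>lower_kappa T. nabla_differentiable T f t) \<and>
                    continuous_on (lower_kappa T) (nabla_derivative T f)}"

end

theory Submission imports Defs begin

text \<open>With \<open>c\<close> the mean value of \<open>f\<close> and \<open>\<eta>\<close> the antiderivative of \<open>f - c\<close> vanishing at \<open>a\<close>,
  also \<open>\<eta> b = 0\<close>, so the hypothesis yields that the integral of
  \<open>(f - c)\<^sup>2 = f * (f - c) - c * (f - c)\<close> is zero.  Hence a monotone antiderivative of
  \<open>(f - c)\<^sup>2\<close> is constant, and \<open>(f - c)\<^sup>2 = 0\<close> by uniqueness of the derivative.
  Antiderivatives of a continuous function \<open>g\<close> on the time scale come from the ordinary integral
  of \<open>g\<close> extended to each gap by its value at the right end of the gap.\<close>

section \<open>Jump operators, the nabla derivative and its uniqueness\<close>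

lemma lower_kappa_subset: "t \<in> lower_kappa S \<Longrightarrow> t \<in> S"
  by (simp add: lower_kappa_def)

lemma backward_jump_le: "backward_jump S t \<le> t"
  by (auto simp: backward_jump_def intro!: cSup_least)

lemma backward_jump_upper: "s \<in> S \<Longrightarrow> s < t \<Longrightarrow> s \<le> backward_jump S t"
  by (auto simp: backward_jump_def intro!: cSup_upper bdd_aboveI[of _ t])

lemma backward_jump_mem:
  assumes "closed S" "t \<in> S"
  shows "backward_jump S t \<in> S"
  using assms by (auto simp: backward_jump_def intro!: closed_subset_contains_Sup bdd_aboveI[of _ t])

text \<open>The equation \<open>backward_jump S t = t\<close> also holds by default when no point of
  \<open>S\<close> lies below \<open>t\<close>. The witness \<open>s\<^sub>0\<close> excludes this
  case, so \<open>t\<close> is a genuine supremum.\<close>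

lemma left_dense_approx:
  assumes "backward_jump S t = t" "s\<^sub>0 \<in> S" "s\<^sub>0 < t" "\<delta> > 0"
  obtains s where "s \<in> S" "s < t" "t - \<delta> < s"
proof -
  have ne: "{s \<in> S. s < t} \<noteq> {}" and sup: "t - \<delta> < Sup {s \<in> S. s < t}"
    using assms by (auto simp: backward_jump_def split: if_splits)
  obtain s where "s \<in> {s \<in> S. s < t}" "t - \<delta> < s"
    using less_cSupD[OF ne sup] by blast
  then show ?thesis using that by auto
qed

lemma has_nabla_derivative_iff:
  "has_nabla_derivative S F D t \<longleftrightarrow> t \<in> lower_kappa S \<and>
     (\<forall>\<epsilon>>0. \<exists>\<delta>>0. \<forall>s\<in>S. \<bar>s - t\<bar> < \<delta> \<longrightarrow>
        \<bar>F (backward_jump S t) - F s - D * (backward_jump S t - s)\<bar> \<le> \<epsilon> * \<bar>backward_jump S t - s\<bar>)"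
proof -
  have nbhd: "(\<exists>U. openin (top_of_set S) U \<and> t \<in> U \<and> (\<forall>s\<in>U. P s))
      \<longleftrightarrow> (\<exists>\<delta>>0. \<forall>s\<in>S. \<bar>s - t\<bar> < \<delta> \<longrightarrow> P s)" if "t \<in> S" for P
  proof
    assume "\<exists>U. openin (top_of_set S) U \<and> t \<in> U \<and> (\<forall>s\<in>U. P s)"
    then show "\<exists>\<delta>>0. \<forall>s\<in>S. \<bar>s - t\<bar> < \<delta> \<longrightarrow> P s"
      unfolding openin_euclidean_subtopology_iff dist_real_def by blast
  next
    assume "\<exists>\<delta>>0. \<forall>s\<in>S. \<bar>s - t\<bar> < \<delta> \<longrightarrow> P s"
    then obtain \<delta> where "\<delta> > 0" "\<forall>s\<in>S. \<bar>s - t\<bar> < \<delta> \<longrightarrow> P s" by blast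
    then show "\<exists>U. openin (top_of_set S) U \<and> t \<in> U \<and> (\<forall>s\<in>U. P s)"
      using that by (intro exI[of _ "S \<inter> ball t \<delta>"]) (auto simp: dist_real_def abs_minus_commute)
  qed
  show ?thesis
    by (simp add: has_nabla_derivative_def nbhd lower_kappa_subset cong: conj_cong)
qed

text \<open>The error terms combine linearly, so accuracy \<epsilon> / (1 + |k|) for each summand
  suffices. This one rule covers differences (\<open>k = -1\<close>) and the correction of one
  antiderivative by a multiple of another.\<close>

lemma has_nabla_derivative_lincomb:
  assumes F: "has_nabla_derivative S F D t" and G: "has_nabla_derivative S G E t"
  shows "has_nabla_derivative S (\<lambda>x. F x + k * G x) (D + k * E) t"
  unfolding has_nabla_derivative_iff
proof (intro conjI allI impI)
  show "t \<in> lower_kappa S" using F by (simp add: has_nabla_derivative_iff)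
next
  fix \<epsilon> :: real assume "\<epsilon> > 0"
  let ?r = "backward_jump S t"
  define e where "e = \<epsilon> / (1 + \<bar>k\<bar>)"
  have "e > 0" and e: "e + \<bar>k\<bar> * e = \<epsilon>"
  proof -
    have "1 + \<bar>k\<bar> > 0" by simp
    then show "e > 0" using \<open>\<epsilon> > 0\<close> by (simp add: e_def)
    have "e + \<bar>k\<bar> * e = e * (1 + \<bar>k\<bar>)" by (simp add: algebra_simps)
    then show "e + \<bar>k\<bar> * e = \<epsilon>" using \<open>1 + \<bar>k\<bar> > 0\<close> by (simp add: e_def)
  qed
  obtain d\<^sub>1 where d1: "d\<^sub>1 > 0"
      "\<And>s. s \<in> S \<Longrightarrow> \<bar>s - t\<bar> < d\<^sub>1 \<Longrightarrow> \<bar>F ?r - F s - D * (?r - s)\<bar> \<le> e * \<bar>?r - s\<bar>"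
    using F \<open>e > 0\<close> unfolding has_nabla_derivative_iff by meson
  obtain d\<^sub>2 where d2: "d\<^sub>2 > 0"
      "\<And>s. s \<in> S \<Longrightarrow> \<bar>s - t\<bar> < d\<^sub>2 \<Longrightarrow> \<bar>G ?r - G s - E * (?r - s)\<bar> \<le> e * \<bar>?r - s\<bar>"
    using G \<open>e > 0\<close> unfolding has_nabla_derivative_iff by meson
  have "\<bar>F ?r + k * G ?r - (F s + k * G s) - (D + k * E) * (?r - s)\<bar> \<le> \<epsilon> * \<bar>?r - s\<bar>"
    if s: "s \<in> S" "\<bar>s - t\<bar> < min d\<^sub>1 d\<^sub>2" for s
  proof -
    have "F ?r + k * G ?r - (F s + k * G s) - (D + k * E) * (?r - s)
        = (F ?r - F s - D * (?r - s)) + k * (G ?r - G s - E * (?r - s))"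
      by (simp add: algebra_simps)
    also have "\<bar>\<dots>\<bar> \<le> \<bar>F ?r - F s - D * (?r - s)\<bar> + \<bar>k\<bar> * \<bar>G ?r - G s - E * (?r - s)\<bar>"
      by (metis abs_mult abs_triangle_ineq)
    also have "\<dots> \<le> e * \<bar>?r - s\<bar> + \<bar>k\<bar> * (e * \<bar>?r - s\<bar>)"
      using d1(2)[of s] d2(2)[of s] s by (intro add_mono mult_left_mono) auto
    also have "\<dots> = (e + \<bar>k\<bar> * e) * \<bar>?r - s\<bar>"
      by (simp add: algebra_simps)
    finally show ?thesis by (simp only: e)
  qed
  then show "\<exists>\<delta>>0. \<forall>s\<in>S. \<bar>s - t\<bar> < \<delta> \<longrightarrow>
      \<bar>F ?r + k * G ?r - (F s + k * G s) - (D + k * E) * (?r - s)\<bar> \<le> \<epsilon> * \<bar>?r - s\<bar>"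
    using d1(1) d2(1) by (intro exI[of _ "min d\<^sub>1 d\<^sub>2"]) auto
qed

lemma has_nabla_derivative_affine:
  "t \<in> lower_kappa S \<Longrightarrow> has_nabla_derivative S (\<lambda>x. k * (x - a)) k t"
  unfolding has_nabla_derivative_iff by (auto simp: algebra_simps intro!: exI[of _ 1])

text \<open>The derivative estimate carries information only at points other than
  \<open>backward_jump S t\<close>. A left-scattered \<open>t\<close> is itself such a point, and a
  left-dense \<open>t\<close> with points below it is approached from the left. A minimum retained
  in \<open>lower_kappa S\<close> is not right-scattered, so with \<open>u\<close> above it, it is
  approached from the right.\<close>

lemma lower_kappa_approx:
  assumes "t \<in> lower_kappa S" "u \<in> S" "u \<noteq> t" "\<delta> > 0"
  obtains s where "s \<in> S" "\<bar>s - t\<bar> < \<delta>" "s \<noteq> backward_jump S t"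
proof (cases "backward_jump S t = t")
  case False
  then show ?thesis using that[of t] assms lower_kappa_subset by auto
next
  case left_dense: True
  show ?thesis
  proof (cases "\<exists>s\<in>S. s < t")
    case True
    then obtain s where "s \<in> S" "s < t" "t - \<delta> < s"
      using left_dense_approx left_dense \<open>\<delta> > 0\<close> by metis
    then show ?thesis using that[of s] left_dense by auto
  next
    case False
    then have "\<not> right_scattered S t" "u > t"
      using assms by (force simp: lower_kappa_def)+
    then have ne: "{s \<in> S. s > t} \<noteq> {}" and inf: "Inf {s \<in> S. s > t} < t + \<delta>"
      using assms by (auto simp: right_scattered_def forward_jump_def split: if_splits)
    obtain s where "s \<in> {s \<in> S. s > t}" "s < t + \<delta>"
      using cInf_lessD[OF ne inf] by blast
    then show ?thesis using that[of s] left_dense by auto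
  qed
qed

text \<open>The zero function gets the derivative \<open>D - E\<close>. Dividing its estimate by a
  nonzero distance bounds |D - E| by every positive \<epsilon>.\<close>

lemma has_nabla_derivative_unique:
  assumes D: "has_nabla_derivative S F D t" and E: "has_nabla_derivative S F E t"
    and u: "u \<in> S" "u \<noteq> t"
  shows "D = E"
proof -
  let ?r = "backward_jump S t"
  have t: "t \<in> lower_kappa S" using D by (simp add: has_nabla_derivative_iff)
  have "\<bar>D - E\<bar> \<le> \<epsilon>" if "\<epsilon> > 0" for \<epsilon> :: real
  proof -
    have "has_nabla_derivative S (\<lambda>x. F x + (-1) * F x) (D + (-1) * E) t"
      by (intro has_nabla_derivative_lincomb D E)
    then have "has_nabla_derivative S (\<lambda>x. 0) (D - E) t" by simp
    then have "\<exists>\<delta>>0. \<forall>s\<in>S. \<bar>s - t\<bar> < \<delta> \<longrightarrow> \<bar>0 - 0 - (D - E) * (?r - s)\<bar> \<le> \<epsilon> * \<bar>?r - s\<bar>"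
      using that by (simp only: has_nabla_derivative_iff)
    then obtain \<delta> where \<delta>: "\<delta> > 0"
        "\<And>s. s \<in> S \<Longrightarrow> \<bar>s - t\<bar> < \<delta> \<Longrightarrow> \<bar>0 - 0 - (D - E) * (?r - s)\<bar> \<le> \<epsilon> * \<bar>?r - s\<bar>"
      by blast
    obtain s where "s \<in> S" "\<bar>s - t\<bar> < \<delta>" "s \<noteq> ?r"
      using lower_kappa_approx[OF t u \<delta>(1)] .
    with \<delta>(2)[of s] show ?thesis by (simp add: abs_mult)
  qed
  with field_le_epsilon[of "\<bar>D - E\<bar>" 0] show ?thesis by simp
qed

lemma nabla_derivative_eq:
  assumes "has_nabla_derivative S F D t" "u \<in> S" "u \<noteq> t"
  shows "nabla_derivative S F t = D"
  unfolding nabla_derivative_def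
  using assms has_nabla_derivative_unique by (intro the_equality) blast+

section \<open>Monotonicity and well-definedness of the nabla integral\<close>

text \<open>At the infimum \<open>t\<^sub>0\<close> of the points violating \<open>F a \<le> F t + \<epsilon> * (t - a)\<close>, the inequality
  propagates from \<open>\<rho> t\<^sub>0\<close> to all nearby points to the right of \<open>\<rho> t\<^sub>0\<close>.\<close>

lemma nabla_derivative_nonneg_imp_ge:
  assumes S: "closed S" "a \<in> S" "S \<subseteq> {a..}"
    and F: "\<And>t. t \<in> lower_kappa S \<Longrightarrow> \<exists>D\<ge>0. has_nabla_derivative S F D t"
    and t: "t \<in> S"
  shows "F a \<le> F t"
proof -
  have *: "F a \<le> F t + \<epsilon> * (t - a)" if "\<epsilon> > 0" for \<epsilon>
  proof (rule ccontr)
    define A where "A = {t \<in> S. F a > F t + \<epsilon> * (t - a)}"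
    define t\<^sub>0 where "t\<^sub>0 = Inf A"
    assume "\<not> ?thesis"
    then have "A \<noteq> {}" using t by (auto simp: A_def)
    have "A \<subseteq> S" by (auto simp: A_def)
    have bdd: "bdd_below A"
      using S \<open>A \<subseteq> S\<close> by (intro bdd_belowI[of _ a]) auto
    have "a \<notin> A" by (simp add: A_def)
    have t0: "t\<^sub>0 \<in> S"
      unfolding t\<^sub>0_def by (rule closed_subset_contains_Inf) fact+
    have lower: "t\<^sub>0 \<le> s" if "s \<in> A" for s
      unfolding t\<^sub>0_def by (rule cInf_lower) fact+
    \<comment> \<open>Otherwise \<open>t\<^sub>0\<close> is the right-scattered minimum
      \<open>a\<close>. Points of \<open>A\<close> differ from \<open>a\<close>, so they lie at or
      beyond \<open>forward_jump S a\<close>, and so does their infimum.\<close>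
    have kappa: "t\<^sub>0 \<in> lower_kappa S"
    proof (rule ccontr)
      assume "t\<^sub>0 \<notin> lower_kappa S"
      then have "t\<^sub>0 = a" "forward_jump S a > a"
        using S t0 by (force simp: lower_kappa_def right_scattered_def)+
      moreover have "forward_jump S a \<le> s" if "s \<in> A" for s
      proof -
        have "s \<in> S" "s > a" using that \<open>a \<notin> A\<close> \<open>A \<subseteq> S\<close> S
          by (auto simp: less_le)
        then show ?thesis
          by (auto simp: forward_jump_def intro!: cInf_lower bdd_belowI[of _ a])
      qed
      then have "forward_jump S a \<le> t\<^sub>0"
        unfolding t\<^sub>0_def using \<open>A \<noteq> {}\<close> by (intro cInf_greatest)
      ultimately show False by simp
    qed
    define r where "r = backward_jump S t\<^sub>0"
    have r: "r \<in> S" "r \<le> t\<^sub>0"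
      unfolding r_def using backward_jump_mem backward_jump_le S t0 by auto
    obtain D where "D \<ge> 0" and "has_nabla_derivative S F D t\<^sub>0"
      using F[OF kappa] by blast
    then obtain \<delta> where \<delta>: "\<delta> > 0"
        "\<And>s. s \<in> S \<Longrightarrow> \<bar>s - t\<^sub>0\<bar> < \<delta> \<Longrightarrow> \<bar>F r - F s - D * (r - s)\<bar> \<le> \<epsilon> * \<bar>r - s\<bar>"
      using \<open>\<epsilon> > 0\<close> unfolding has_nabla_derivative_iff r_def by meson
    \<comment> \<open>Membership forces \<open>r = t\<^sub>0\<close>, a left-dense point. Points
      \<open>s\<close> just left of it are outside \<open>A\<close>, and from \<open>s\<close> to
      \<open>r\<close> the function drops by at most \<open>\<epsilon> * (r - s)\<close>, which puts
      \<open>r\<close> outside \<open>A\<close> too.\<close>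
    have "r \<notin> A"
    proof
      assume "r \<in> A"
      then have "r = t\<^sub>0" "a < t\<^sub>0"
        using lower r S \<open>a \<notin> A\<close> by (auto simp: less_le intro: antisym)
      then obtain s where s: "s \<in> S" "s < t\<^sub>0" "t\<^sub>0 - \<delta> < s"
        using left_dense_approx[of S t\<^sub>0 a \<delta>] S \<delta>(1) r_def by auto
      have "D * (r - s) \<ge> 0"
        using s \<open>r = t\<^sub>0\<close> \<open>D \<ge> 0\<close> by simp
      moreover have "\<bar>F r - F s - D * (r - s)\<bar> \<le> \<epsilon> * (r - s)"
        using \<delta>(2)[of s] s \<open>r = t\<^sub>0\<close> by simp
      moreover have "F a \<le> F s + \<epsilon> * (s - a)"
        using lower[of s] s by (force simp: A_def)
      moreover have "F a > F r + \<epsilon> * (r - a)"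
        using \<open>r \<in> A\<close> by (simp add: A_def)
      ultimately show False by (simp add: algebra_simps)
    qed
    \<comment> \<open>The same bound on the drop, now from \<open>r\<close> to the right,
      contradicts the presence of points of \<open>A\<close> arbitrarily close to its
      infimum.\<close>
    obtain s where s: "s \<in> A" "s < t\<^sub>0 + \<delta>"
      using cInf_lessD[OF \<open>A \<noteq> {}\<close>, of "t\<^sub>0 + \<delta>"] \<delta>(1) t\<^sub>0_def by auto
    then have "r \<le> s" using lower r by fastforce
    then have "D * (s - r) \<ge> 0"
      using \<open>D \<ge> 0\<close> by simp
    moreover have "\<bar>F r - F s - D * (r - s)\<bar> \<le> \<epsilon> * (s - r)"
      using \<delta>(2)[of s] s lower[of s] \<open>A \<subseteq> S\<close> \<open>r \<le> s\<close> by auto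
    moreover have "F a \<le> F r + \<epsilon> * (r - a)"
      using \<open>r \<notin> A\<close> r by (simp add: A_def)
    moreover have "F a > F s + \<epsilon> * (s - a)"
      using s by (simp add: A_def)
    ultimately show False by (simp add: algebra_simps)
  qed
  show ?thesis
  proof (cases "t = a")
    case False
    then have "t - a > 0" using S t by auto
    show ?thesis
    proof (rule field_le_epsilon)
      fix e :: real assume "e > 0"
      then show "F a \<le> F t + e" using *[of "e / (t - a)"] \<open>t - a > 0\<close> by simp
    qed
  qed simp
qed

text \<open>The difference of two antiderivatives has derivative 0, so monotonicity applies to it in
  either order of subtraction.\<close>

lemma antiderivative_increment_unique:
  assumes S: "closed S" "a \<in> S" "S \<subseteq> {a..}"
    and F: "\<And>t. t \<in> lower_kappa S \<Longrightarrow> has_nabla_derivative S F (g t) t"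
    and G: "\<And>t. t \<in> lower_kappa S \<Longrightarrow> has_nabla_derivative S G (g t) t"
    and b: "b \<in> S"
  shows "F b - F a = G b - G a"
proof -
  have ge: "H a - K a \<le> H b - K b"
    if H: "\<And>t. t \<in> lower_kappa S \<Longrightarrow> has_nabla_derivative S H (g t) t"
      and K: "\<And>t. t \<in> lower_kappa S \<Longrightarrow> has_nabla_derivative S K (g t) t" for H K
  proof -
    have "\<exists>D\<ge>0. has_nabla_derivative S (\<lambda>x. H x + (-1) * K x) D t" if "t \<in> lower_kappa S" for t
      using has_nabla_derivative_lincomb[OF H[OF that] K[OF that], of "-1"]
      by (intro exI[of _ 0]) simp
    with S b have "H a + (-1) * K a \<le> H b + (-1) * K b"
      by (intro nabla_derivative_nonneg_imp_ge[of S a "\<lambda>x. H x + (-1) * K x"]) auto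
    then show ?thesis by simp
  qed
  have "F a - G a \<le> F b - G b" "G a - F a \<le> G b - F b"
    by (intro ge F G; assumption)+
  then show ?thesis by simp
qed

lemma nabla_integral_eq:
  assumes "closed S" "a \<in> S" "S \<subseteq> {a..}" "b \<in> S"
    and "\<And>t. t \<in> lower_kappa S \<Longrightarrow> has_nabla_derivative S F (g t) t"
  shows "nabla_integral S a b g = F b - F a"
  unfolding nabla_integral_def
proof (rule the_equality)
  show "\<exists>F'. (\<forall>t\<in>lower_kappa S. has_nabla_derivative S F' (g t) t) \<and> F b - F a = F' b - F' a"
    using assms by blast
next
  fix I assume "\<exists>F'. (\<forall>t\<in>lower_kappa S. has_nabla_derivative S F' (g t) t) \<and> I = F' b - F' a"
  then show "I = F b - F a"
    using antiderivative_increment_unique[OF assms(1-3)] assms(4-5) by blast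
qed

section \<open>Antiderivatives of continuous functions\<close>

text \<open>The identity on \<open>S\<close>, and the right end on each gap. The right end is chosen
  because at a left-scattered \<open>t\<close> the nabla derivative is the slope from
  \<open>backward_jump S t\<close> to \<open>t\<close>, and this slope has to be
  \<open>g t\<close>.\<close>

definition next_point :: "real set \<Rightarrow> real \<Rightarrow> real" where
  "next_point S x = Inf {s \<in> S. x \<le> s}"

lemma
  assumes "closed S" "b \<in> S" "x \<le> b"
  shows next_point_mem: "next_point S x \<in> S" and next_point_ge: "x \<le> next_point S x"
proof -
  have "next_point S x \<in> S \<inter> {x..}"
    unfolding next_point_def using assms
    by (intro closed_subset_contains_Inf bdd_belowI[of _ x]) auto
  then show "next_point S x \<in> S" "x \<le> next_point S x" by auto
qed

lemma next_point_le: "s \<in> S \<Longrightarrow> x \<le> s \<Longrightarrow> next_point S x \<le> s"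
  unfolding next_point_def by (intro cInf_lower bdd_belowI[of _ x]) auto

text \<open>The truncation at \<open>b\<close> keeps the infimum in \<^const>\<open>next_point\<close> away from the empty set.\<close>

lemma mono_next_point:
  assumes "closed S" "b \<in> S"
  shows "mono (\<lambda>x. next_point S (min x b))"
proof
  fix x y :: real assume "x \<le> y"
  then show "next_point S (min x b) \<le> next_point S (min y b)"
    using next_point_mem[OF assms, of "min y b"] next_point_ge[OF assms, of "min y b"]
    by (intro next_point_le) auto
qed

text \<open>Since \<open>g\<close> is controlled only on \<open>S\<close>, the Tietze theorem
  replaces it by a globally continuous \<open>h\<close>. Composed with the monotone, hence Borel,
  truncated \<open>next_point\<close> it is measurable, and compactness of \<open>S\<close> bounds
  it.\<close>

lemma next_point_extension_integrable:
  fixes g :: "real \<Rightarrow> real"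
  assumes S: "closed S" "b \<in> S" "S \<subseteq> {a..b}" and g: "continuous_on S g"
  shows "(\<lambda>x. g (next_point S x)) integrable_on {a..b}"
proof -
  obtain h where h: "continuous_on UNIV h" "\<And>x. x \<in> S \<Longrightarrow> h x = g x"
    using Tietze_unbounded[OF g, of UNIV] S by auto
  have "(\<lambda>x. h (next_point S (min x b))) \<in> borel_measurable borel"
    using borel_measurable_mono[OF mono_next_point[OF S(1,2)]] borel_measurable_continuous_onI[OF h(1)]
    by simp
  then have "(\<lambda>x. h (next_point S (min x b))) \<in> borel_measurable lebesgue"
    by (simp add: measurable_completion)
  then have meas: "(\<lambda>x. h (next_point S (min x b))) \<in> borel_measurable (lebesgue_on {a..b})"
    by (rule measurable_restrict_space1)
  have "compact S"
    using S by (metis bounded_closed_interval bounded_subset compact_eq_bounded_closed)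
  then obtain B where B: "\<And>x. x \<in> S \<Longrightarrow> \<bar>g x\<bar> \<le> B"
    using compact_imp_bounded[OF compact_continuous_image[OF g]] unfolding bounded_iff by auto
  have "(\<lambda>x. h (next_point S (min x b))) integrable_on {a..b}"
  proof (rule measurable_bounded_by_integrable_imp_integrable_real[OF meas])
    show "(\<lambda>x. B) integrable_on {a..b}" by (rule integrable_const_ivl)
    show "\<bar>h (next_point S (min x b))\<bar> \<le> B" for x
      using next_point_mem[OF S(1,2), of "min x b"] h(2) B by simp
  qed simp
  moreover have "h (next_point S (min x b)) = g (next_point S x)" if "x \<in> {a..b}" for x
    using that next_point_mem[OF S(1,2), of x] h(2) by (simp add: min_def)
  ultimately show ?thesis
    by (rule integrable_eq)
qed

text \<open>The left end is exempt, a single point being negligible. This matters when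
  \<open>u\<close> starts a gap: there the extended integrand still takes its value at
  \<open>u\<close>, not at the right end of the gap.\<close>

lemma integral_near_const:
  fixes h :: "real \<Rightarrow> real"
  assumes h: "h integrable_on {u..v}" and "u \<le> v" "0 \<le> e"
    and near: "\<And>x. u < x \<Longrightarrow> x \<le> v \<Longrightarrow> \<bar>h x - k\<bar> \<le> e"
  shows "\<bar>integral {u..v} h - k * (v - u)\<bar> \<le> e * (v - u)"
proof -
  have "((\<lambda>x. h x - k) has_integral (integral {u..v} h - k * (v - u))) (cbox u v)"
    using has_integral_diff[OF integrable_integral[OF h] has_integral_const_real[of k u v]] \<open>u \<le> v\<close>
    by (simp add: mult.commute)
  from has_integral_bound_spike_finite[OF \<open>0 \<le> e\<close> _ this, of "{u}"] near \<open>u \<le> v\<close>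
  show ?thesis by (auto simp: less_le)
qed

text \<open>Between \<open>backward_jump S t\<close> and a nearby \<open>s\<close>, apart from the
  lower end, the integrand only takes values of \<open>g\<close> at points of \<open>S\<close> close
  to \<open>t\<close>, and these are close to \<open>g t\<close>.\<close>

lemma has_nabla_derivative_integral:
  assumes S: "closed S" "b \<in> S" "S \<subseteq> {a..b}" and g: "continuous_on S g"
    and t: "t \<in> lower_kappa S"
  shows "has_nabla_derivative S (\<lambda>t. integral {a..t} (\<lambda>x. g (next_point S x))) (g t) t"
proof -
  define h where "h = (\<lambda>x. g (next_point S x))"
  define F where "F = (\<lambda>t. integral {a..t} h)"
  define r where "r = backward_jump S t"
  have tS: "t \<in> S" using t by (rule lower_kappa_subset)
  have r: "r \<in> S" "r \<le> t"
    unfolding r_def using backward_jump_mem backward_jump_le S tS by auto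
  have int: "h integrable_on {u..v}" if "a \<le> u" "v \<le> b" for u v
    using next_point_extension_integrable[OF S g] that unfolding h_def
    by (auto intro: integrable_subinterval_real)
  have F_diff: "F v - F u = integral {u..v} h" if "u \<in> S" "v \<in> S" "u \<le> v" for u v
    using Henstock_Kurzweil_Integration.integral_combine[of a u v h] int[of a v] that S
    by (force simp: F_def)
  have "\<exists>\<delta>>0. \<forall>s\<in>S. \<bar>s - t\<bar> < \<delta> \<longrightarrow> \<bar>F r - F s - g t * (r - s)\<bar> \<le> \<epsilon> * \<bar>r - s\<bar>"
    if \<epsilon>: "\<epsilon> > 0" for \<epsilon>
  proof -
    obtain d where d: "d > 0" "\<forall>s\<in>S. \<bar>s - t\<bar> < d \<longrightarrow> \<bar>g s - g t\<bar> < \<epsilon>"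
      using g tS \<epsilon> unfolding continuous_on_iff dist_real_def by blast
    \<comment> \<open>For left-scattered \<open>t\<close>, a radius of at most \<open>t - r\<close>
      keeps only points \<open>s\<close> with \<open>t \<le> s\<close>, as \<open>S\<close> has no
      point strictly between \<open>r\<close> and \<open>t\<close>.\<close>
    define \<delta> where "\<delta> = (if r < t then min d (t - r) else d)"
    have "\<delta> > 0" "\<delta> \<le> d" using d by (auto simp: \<delta>_def)
    have "\<bar>F r - F s - g t * (r - s)\<bar> \<le> \<epsilon> * \<bar>r - s\<bar>" if s: "s \<in> S" "\<bar>s - t\<bar> < \<delta>" for s
    proof -
      have bounds: "a \<le> r" "r \<le> b" "a \<le> s" "s \<le> b" using r s S by auto
      have side: "t \<le> s" if "r < t"
        using s that backward_jump_upper[of s S t] by (force simp: \<delta>_def r_def)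
      \<comment> \<open>From above, \<open>max r s\<close> is in \<open>S\<close>, so
        \<open>next_point S x\<close> cannot pass it. From below, if \<open>r < t\<close> then the
        first point of \<open>S\<close> after \<open>r\<close> is \<open>t\<close>; otherwise
        \<open>r = t\<close>, and \<open>x\<close> already exceeds \<open>min r s\<close>.\<close>
      have near: "\<bar>h x - g t\<bar> \<le> \<epsilon>" if x: "min r s < x" "x \<le> max r s" for x
      proof -
        have "x \<le> b" using x bounds by auto
        note n = next_point_mem[OF S(1,2) this] next_point_ge[OF S(1,2) this]
        have "next_point S x \<le> max r s"
          using x r s by (intro next_point_le) (auto simp: max_def)
        moreover have "min t s \<le> next_point S x"
        proof (cases "r < t")
          case True
          then have "r < next_point S x" using n x side by auto
          then show ?thesis
            using backward_jump_upper[OF n(1), of t] by (force simp: r_def)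
        next
          case False
          then show ?thesis using r n x by auto
        qed
        ultimately have "\<bar>next_point S x - t\<bar> < d"
          using s r side \<open>\<delta> \<le> d\<close> \<open>\<delta> > 0\<close> by (auto simp: max_def min_def split: if_splits)
        then show ?thesis using d(2) n(1) by (auto simp: h_def less_imp_le)
      qed
      show ?thesis
      proof (cases "r \<le> s")
        case True
        have "\<bar>integral {r..s} h - g t * (s - r)\<bar> \<le> \<epsilon> * (s - r)"
          using True near int bounds \<open>\<epsilon> > 0\<close> by (intro integral_near_const) auto
        moreover have "F r - F s - g t * (r - s) = - (integral {r..s} h - g t * (s - r))"
          using F_diff[OF r(1) s(1) True] by (simp add: algebra_simps)
        ultimately show ?thesis using True by simp
      next
        case False
        have "\<bar>integral {s..r} h - g t * (r - s)\<bar> \<le> \<epsilon> * (r - s)"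
          using False near int bounds \<open>\<epsilon> > 0\<close> by (intro integral_near_const) auto
        then show ?thesis using False F_diff[of s r] r s by simp
      qed
    qed
    then show ?thesis using \<open>\<delta> > 0\<close> by blast
  qed
  then show ?thesis
    using t unfolding has_nabla_derivative_iff F_def h_def r_def by blast
qed

section \<open>The test function and the vanishing of the squared deviation\<close>

theorem lemma14:
  fixes T :: "real set" and a b :: real and f :: "real \<Rightarrow> real"
  assumes "time_scale T"
    and "a \<in> T" and "b \<in> T" and "a < b"
    and "continuous_on (ts_interval T a b) f"
    and "\<And>\<eta>. \<eta> \<in> nabla_C1 (ts_interval T a b) \<Longrightarrow> \<eta> a = 0 \<Longrightarrow> \<eta> b = 0 \<Longrightarrow>
           nabla_integral (ts_interval T a b) a b
             (\<lambda>t. f t * nabla_derivative (ts_interval T a b) \<eta> t) = 0"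
  shows "\<exists>c. \<forall>t\<in>lower_kappa (ts_interval T a b). f t = c"
proof -
  define S where "S = ts_interval T a b"
  have "S = T \<inter> {a..b}" by (auto simp: S_def ts_interval_def)
  then have S: "closed S" "a \<in> S" "b \<in> S" "S \<subseteq> {a..b}" "S \<subseteq> {a..}"
    using assms(1-4) by (auto simp: time_scale_def)
  have f: "continuous_on S f" using assms(5) by (simp add: S_def)
  \<comment> \<open>Excludes the one-point time scale, where every number is a derivative.\<close>
  have two_points: "\<exists>u\<in>S. u \<noteq> t" for t
    using S(2,3) \<open>a < b\<close> by (metis less_irrefl)
  define F where "F = (\<lambda>t. integral {a..t} (\<lambda>x. f (next_point S x)))"
  define c where "c = F b / (b - a)"
  define \<eta> where "\<eta> = (\<lambda>t. F t + (-1) * (c * (t - a)))"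
  have \<eta>': "has_nabla_derivative S \<eta> (f t - c) t" if "t \<in> lower_kappa S" for t
  proof -
    have "has_nabla_derivative S \<eta> (f t + (-1) * c) t"
      unfolding \<eta>_def F_def
      by (intro has_nabla_derivative_lincomb has_nabla_derivative_affine
          has_nabla_derivative_integral[OF S(1,3,4) f] that)
    then show ?thesis by simp
  qed
  then have \<eta>'_eq: "nabla_derivative S \<eta> t = f t - c" if "t \<in> lower_kappa S" for t
    using that two_points nabla_derivative_eq by blast
  have "continuous_on (lower_kappa S) (\<lambda>t. f t - c)"
    by (intro continuous_intros continuous_on_subset[OF f]) (auto dest: lower_kappa_subset)
  then have "\<eta> \<in> nabla_C1 S"
    using \<eta>' \<eta>'_eq by (auto simp: nabla_C1_def nabla_differentiable_def cong: continuous_on_cong)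
  moreover have ends: "\<eta> a = 0" "\<eta> b = 0"
    using \<open>a < b\<close> by (auto simp: \<eta>_def F_def c_def)
  ultimately have zero: "nabla_integral S a b (\<lambda>t. f t * nabla_derivative S \<eta> t) = 0"
    using assms(6) by (simp add: S_def)

  define q where "q = (\<lambda>x. (f (next_point S x) - c)\<^sup>2)"
  define G where "G = (\<lambda>t. integral {a..t} q)"
  have sq: "continuous_on S (\<lambda>t. (f t - c)\<^sup>2)"
    by (intro continuous_intros f)
  have G': "has_nabla_derivative S G ((f t - c)\<^sup>2) t" if "t \<in> lower_kappa S" for t
    using has_nabla_derivative_integral[OF S(1,3,4) sq that] by (simp add: G_def q_def)
  \<comment> \<open>Adding \<open>c * \<eta>\<close> turns the derivative of \<open>G\<close> into
    the integrand of the hypothesis and leaves the increment from \<open>a\<close> to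
    \<open>b\<close> unchanged, since \<eta> vanishes at both ends.\<close>
  have "has_nabla_derivative S (\<lambda>t. G t + c * \<eta> t) (f t * nabla_derivative S \<eta> t) t"
    if "t \<in> lower_kappa S" for t
  proof -
    have "f t * nabla_derivative S \<eta> t = (f t - c)\<^sup>2 + c * (f t - c)"
      by (simp add: \<eta>'_eq[OF that] power2_eq_square algebra_simps)
    then show ?thesis
      using has_nabla_derivative_lincomb[OF G'[OF that] \<eta>'[OF that]] by simp
  qed
  from nabla_integral_eq[OF S(1,2,5,3) this] zero ends have "G b = G a" by simp
  then have "G b = 0" by (simp add: G_def)
  have int: "q integrable_on {a..b}"
    unfolding q_def by (rule next_point_extension_integrable[OF S(1,3,4) sq])
  \<comment> \<open>The integrand \<open>q\<close> is a square, so \<open>G t\<close> lies between 0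
    and \<open>G b = 0\<close>.\<close>
  have G0: "G t = 0" if "t \<in> S" for t
  proof (rule antisym)
    have sub: "q integrable_on {a..t}" "{a..t} \<subseteq> {a..b}"
      using that S by (auto intro!: integrable_subinterval_real[OF int])
    have "G t \<le> G b"
      unfolding G_def by (rule integral_subset_le) (use sub int in \<open>auto simp: q_def\<close>)
    then show "G t \<le> 0" using \<open>G b = 0\<close> by simp
    show "0 \<le> G t"
      unfolding G_def by (rule integral_nonneg) (use sub in \<open>auto simp: q_def\<close>)
  qed
  have "f t = c" if t: "t \<in> lower_kappa S" for t
  proof -
    \<comment> \<open>The estimate at \<open>t\<close> evaluates \<open>G\<close> only at
      \<open>backward_jump S t\<close> and at points of \<open>S\<close>, so vanishing on
      \<open>S\<close> gives derivative 0; the radius 1 is arbitrary.\<close>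
    have "backward_jump S t \<in> S"
      using backward_jump_mem[OF S(1)] lower_kappa_subset[OF t] .
    then have "has_nabla_derivative S G 0 t"
      using t G0 by (auto simp: has_nabla_derivative_iff intro: exI[of _ 1])
    then have "(f t - c)\<^sup>2 = 0"
      using has_nabla_derivative_unique G'[OF t] two_points by blast
    then show ?thesis by simp
  qed
  then show ?thesis unfolding S_def by blast
qed

end
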